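(* Let $p$ be a prime and let $G$ be a group. If $G$ is weakly residually $p$-nilpotent, then $G$ is residually $p$.
   Context: A $p$-group is a finite group of order a power of $p$. A group $G$ is residually $p$ if for every $g\in G$ with $g\ne 1$ there is a homomorphism $\alpha\colon G\to P$ to a $p$-group $P$ with $\alpha(g)\neq 1$. A group $G$ is weakly residually $p$-nilpotent if for every $g\in G$ with $g\neq 1$ there exists a finite chain of subgroups $H=H_0\triangleleft H_1\triangleleft\cdots\triangleleft H_n=G$ such that each $H_i$ is normal in $H_{i+1}$, each quotient $H_{i+1}/H_i$ is isomorphic to $\mathbb{Z}/p\mathbb{Z}$, and $g\notin H$. *)

theory Defs
  imports "HOL-Algebra.Algebra" "HOL-Computational_Algebra.Primes"
begin

definition p_group :: "nat \<Rightarrow> ('a, 'b) monoid_scheme \<Rightarrow> bool" where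
  "p_group p P \<longleftrightarrow> group P \<and> finite (carrier P) \<and> (\<exists>k. order P = p ^ k)"

(* The target group is taken with carrier in nat, since a definition cannot quantify over types.
   Every finite group has an isomorphic copy on natural numbers, so this is no restriction:
   see residually_p_witness below. *)
definition residually_p :: "nat \<Rightarrow> ('a, 'b) monoid_scheme \<Rightarrow> bool" where
  "residually_p p G \<longleftrightarrow>
     (\<forall>g \<in> carrier G. g \<noteq> \<one>\<^bsub>G\<^esub> \<longrightarrow>
        (\<exists>(P :: nat monoid) \<alpha>. p_group p P \<and> \<alpha> \<in> hom G P \<and> \<alpha> g \<noteq> \<one>\<^bsub>P\<^esub>))"

definition weakly_residually_p_nilpotent :: "nat \<Rightarrow> ('a, 'b) monoid_scheme \<Rightarrow> bool" where
  "weakly_residually_p_nilpotent p G \<longleftrightarrow>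
     (\<forall>g \<in> carrier G. g \<noteq> \<one>\<^bsub>G\<^esub> \<longrightarrow>
        (\<exists>(n :: nat) (H :: nat \<Rightarrow> 'a set).
           H n = carrier G \<and>
           (\<forall>i \<le> n. subgroup (H i) G) \<and>
           (\<forall>i < n. H i \<lhd> G\<lparr>carrier := H (Suc i)\<rparr> \<and>
                    G\<lparr>carrier := H (Suc i)\<rparr> Mod H i \<cong> integer_mod_group p) \<and>
           g \<notin> H 0))"

lemma residually_p_witness:
  fixes G :: "('a, 'b) monoid_scheme" and P :: "('c, 'd) monoid_scheme"
  assumes P: "p_group p P" and \<alpha>: "\<alpha> \<in> hom G P" and g: "g \<in> carrier G" "\<alpha> g \<noteq> \<one>\<^bsub>P\<^esub>"
  shows "\<exists>(Q :: nat monoid) \<beta>. p_group p Q \<and> \<beta> \<in> hom G Q \<and> \<beta> g \<noteq> \<one>\<^bsub>Q\<^esub>"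
proof -
  interpret P: group P using P by (simp add: p_group_def)
  obtain f :: "'c \<Rightarrow> nat" where f: "inj_on f (carrier P)"
    using P finite_imp_inj_to_nat_seg unfolding p_group_def by blast
  define r where "r = inv_into (carrier P) f"
  have r: "r (f x) = x" if "x \<in> carrier P" for x
    using that f by (simp add: r_def)
  define Q :: "nat monoid" where
    "Q = \<lparr>carrier = f ` carrier P, monoid.mult = (\<lambda>a b. f (r a \<otimes>\<^bsub>P\<^esub> r b)), one = f \<one>\<^bsub>P\<^esub>\<rparr>"
  have "group Q"
  proof (rule groupI)
    fix x assume "x \<in> carrier Q"
    then obtain a where a: "a \<in> carrier P" "x = f a" by (auto simp: Q_def)
    show "\<exists>y\<in>carrier Q. y \<otimes>\<^bsub>Q\<^esub> x = \<one>\<^bsub>Q\<^esub>"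
      by (rule bexI[of _ "f (inv\<^bsub>P\<^esub> a)"]) (use a in \<open>auto simp: Q_def r\<close>)
  qed (auto simp: Q_def r P.m_assoc)
  moreover have "order Q = order P"
    by (simp add: order_def Q_def card_image f)
  ultimately have "p_group p Q"
    using P by (auto simp: p_group_def Q_def)
  moreover have "(\<lambda>x. f (\<alpha> x)) \<in> hom G Q"
    using \<alpha> by (auto simp: hom_def Pi_iff Q_def r)
  moreover have "f (\<alpha> g) \<noteq> \<one>\<^bsub>Q\<^esub>"
  proof
    assume "f (\<alpha> g) = \<one>\<^bsub>Q\<^esub>"
    moreover have "\<alpha> g \<in> carrier P" using \<alpha> g by (auto simp: hom_def)
    ultimately show False using g f by (auto simp: Q_def dest: inj_onD)
  qed
  ultimately show ?thesis by blast
qed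

end

theory Submission
  imports Defs
begin

text \<open>
  Let \<open>H\<^sub>0 \<lhd> \<dots> \<lhd> H\<^sub>n = G\<close> be a chain whose factors have order \<open>p\<close>, with \<open>g \<notin> H\<^sub>0\<close>. The group
  \<open>H\<^sub>0\<close> need not be normal in \<open>G\<close>, so \<open>G / H\<^sub>0\<close> is replaced by the permutation group \<open>P\<close> that \<open>G\<close>
  induces on the set of cosets of \<open>H\<^sub>0\<close>. This set is finite, because each factor of the chain is
  finite; hence so is \<open>P\<close>. Only the coset \<open>H\<^sub>0\<close> matters to see that \<open>g\<close> acts nontrivially:
  its stabilizer is \<open>H\<^sub>0\<close>.

  It remains to see that \<open>P\<close> is a \<open>p\<close>-group. Raising to the \<open>p\<close>-th power maps each term of the
  chain into the term below it, so \<open>x\<close> to the power \<open>p ^ n\<close> lies in \<open>H\<^sub>0\<close> for \<^emph>\<open>every\<close> \<open>x\<close> in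
  \<open>G\<close>. Applied to all conjugates of \<open>x\<close>, this says that the power fixes every coset. So \<open>P\<close> has
  exponent dividing \<open>p ^ n\<close>, and by Cauchy's theorem no prime other than \<open>p\<close> divides its order.

  The two facts read off from the chain are \<open>subnormal_chain_powers_and_index\<close>; that they suffice
  is \<open>p_group_quotient_if_powers_in_subgroup\<close>, which rests on \<open>p_group_if_exponent_prime_power\<close>.
\<close>

section \<open>Finite groups of prime power exponent\<close>

lemma Cauchy_prime_order_element:
  fixes q :: nat
  assumes q: "Factorial_Ring.prime q" and "group P" and fin: "finite (carrier P)"
    and dvd: "q dvd order P"
  obtains x where "x \<in> carrier P" "x \<noteq> \<one>\<^bsub>P\<^esub>" "x [^]\<^bsub>P\<^esub> q = \<one>\<^bsub>P\<^esub>"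
proof -
  interpret group P by fact
  obtain m where "order P = q ^ 1 * m"
    using dvd by auto
  then obtain H where H: "subgroup H P" "card H = q ^ 1"
    using sylow_thm[OF q \<open>group P\<close> _ fin] by blast
  have "1 < card H"
    using H q prime_gt_1_nat by simp
  then have "\<not> H \<subseteq> {\<one>\<^bsub>P\<^esub>}"
    using card_mono[of "{\<one>\<^bsub>P\<^esub>}" H] by auto
  then obtain x where x: "x \<in> H" "x \<noteq> \<one>\<^bsub>P\<^esub>"
    by blast
  interpret H: group "P\<lparr>carrier := H\<rparr>"
    using H(1) by (rule subgroup_imp_group)
  have "x [^]\<^bsub>P\<^esub> q = \<one>\<^bsub>P\<^esub>"
    using H.pow_order_eq_1[of x] x(1) H(2) by (simp add: order_def flip: nat_pow_consistent)
  then show ?thesis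
    using that[of x] x subgroup.subset[OF H(1)] by blast
qed

text \<open>
  An element whose order is a prime \<open>q \<noteq> p\<close> would be killed by the two coprime exponents \<open>q\<close> and
  \<open>p ^ n\<close>, hence trivial; so Cauchy's theorem leaves \<open>p\<close> as the only possible prime divisor of
  the order.
\<close>
lemma p_group_if_exponent_prime_power:
  fixes p :: nat
  assumes p: "Factorial_Ring.prime p" and "group P" and fin: "finite (carrier P)"
    and exponent: "\<And>x. x \<in> carrier P \<Longrightarrow> x [^]\<^bsub>P\<^esub> (p ^ n) = \<one>\<^bsub>P\<^esub>"
  shows "p_group p P"
proof -
  interpret group P by fact
  have prime_divisor: "q = p" if q: "Factorial_Ring.prime q" "q dvd order P" for q
  proof (rule ccontr)
    assume "q \<noteq> p"
    then have "coprime q (p ^ n)"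
      using p q(1) by (simp add: primes_coprime)
    obtain x where x: "x \<in> carrier P" "x \<noteq> \<one>\<^bsub>P\<^esub>" "x [^]\<^bsub>P\<^esub> q = \<one>\<^bsub>P\<^esub>"
      using Cauchy_prime_order_element[OF q(1) \<open>group P\<close> fin q(2)] .
    then have "ord x dvd q" "ord x dvd p ^ n"
      using exponent pow_eq_id by auto
    then have "ord x = 1"
      using \<open>coprime q (p ^ n)\<close> coprime_common_divisor_nat by blast
    then show False
      using x pow_ord_eq_1[of x] by simp
  qed
  have "order P \<noteq> 0"
    using fin order_gt_0_iff_finite by simp
  then obtain m where m: "order P = p ^ multiplicity p (order P) * m" "\<not> p dvd m"
    using p multiplicity_decompose'[of "order P" p] not_prime_unit by metis
  have "m = 1"
  proof (rule ccontr)
    assume "m \<noteq> 1"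
    then obtain q where "Factorial_Ring.prime q" "q dvd m"
      using prime_factor_nat by blast
    then show False
      using prime_divisor m by (metis dvd_mult)
  qed
  then show ?thesis
    using m(1) \<open>group P\<close> fin unfolding p_group_def by auto
qed

section \<open>The action on the cosets of a subgroup\<close>

definition coset_action :: "('a, 'b) monoid_scheme \<Rightarrow> 'a set \<Rightarrow> 'a \<Rightarrow> 'a set \<Rightarrow> 'a set" where
  "coset_action G H g = (\<lambda>M \<in> rcosets\<^bsub>G\<^esub> H. M #>\<^bsub>G\<^esub> inv\<^bsub>G\<^esub> g)"

context group
begin

text \<open>The inverse turns right multiplication of right cosets into a left action.\<close>
lemma coset_action_hom:
  assumes H: "subgroup H G"
  shows "coset_action G H \<in> hom G (BijGroup (rcosets H))"
proof -
  have closed: "M #> x \<in> rcosets H" if M: "M \<in> rcosets H" and x: "x \<in> carrier G" for M x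
  proof -
    obtain y where "y \<in> carrier G" "M = H #> y"
      using M unfolding RCOSETS_def by blast
    then show ?thesis
      using x H by (simp add: coset_mult_assoc rcosetsI subgroup.subset)
  qed
  have sub: "M \<subseteq> carrier G" if "M \<in> rcosets H" for M
    using that H by (metis subgroup.rcosets_carrier is_group)
  have bij: "coset_action G H g \<in> Bij (rcosets H)" if g: "g \<in> carrier G" for g
    unfolding Bij_def coset_action_def
    by (auto intro!: bij_betwI[where g = "\<lambda>M. M #> g"] simp: closed sub coset_mult_assoc g)
  show ?thesis
  proof (rule homI)
    fix x y assume xy: "x \<in> carrier G" "y \<in> carrier G"
    show "coset_action G H (x \<otimes> y) =
        coset_action G H x \<otimes>\<^bsub>BijGroup (rcosets H)\<^esub> coset_action G H y"
      using bij[OF xy(1)] bij[OF xy(2)] xy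
      by (auto simp: BijGroup_def compose_def coset_action_def closed sub coset_mult_assoc
          inv_mult_group intro!: restrict_ext)
  qed (simp add: bij BijGroup_def)
qed

lemma coset_action_eq_one_iff:
  assumes H: "subgroup H G" and g: "g \<in> carrier G"
  shows "coset_action G H g = \<one>\<^bsub>BijGroup (rcosets H)\<^esub> \<longleftrightarrow>
    (\<forall>x \<in> carrier G. x \<otimes> g \<otimes> inv x \<in> H)"
proof -
  have "H #> x #> inv g = H #> x \<longleftrightarrow> x \<otimes> g \<otimes> inv x \<in> H" if x: "x \<in> carrier G" for x
  proof -
    have "H #> x #> inv g = H #> x \<longleftrightarrow> x \<otimes> inv (x \<otimes> inv g) \<in> H"
      using H x g
      by (metis coset_join1 coset_join2 coset_mult_assoc coset_mult_inv1 coset_mult_inv2 inv_closed m_closed subgroup.subset)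
    then show ?thesis
      using x g by (simp add: inv_mult_group m_assoc)
  qed
  then show ?thesis
    by (auto simp: BijGroup_def coset_action_def RCOSETS_def fun_eq_iff restrict_def)
qed

text \<open>
  The hypothesis on powers is imposed on all elements of \<open>G\<close>, so it is inherited by conjugates: this
  is how a condition on \<open>H\<close> alone gives information on the kernel, which is the intersection
  of the conjugates of \<open>H\<close>.
\<close>
lemma p_group_quotient_if_powers_in_subgroup:
  fixes p :: nat
  assumes p: "Factorial_Ring.prime p" and H: "subgroup H G" and fin: "finite (rcosets H)"
    and powers: "\<And>x. x \<in> carrier G \<Longrightarrow> x [^] (p ^ n) \<in> H"
    and g: "g \<in> carrier G" "g \<notin> H"
  obtains P :: "('a set \<Rightarrow> 'a set) monoid" and \<alpha>
  where "p_group p P" "\<alpha> \<in> hom G P" "\<alpha> g \<noteq> \<one>\<^bsub>P\<^esub>"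
proof -
  define B where "B = BijGroup (rcosets H)"
  define \<alpha> where "\<alpha> = coset_action G H"
  define P where "P = B\<lparr>carrier := \<alpha> ` carrier G\<rparr>"
  interpret \<alpha>: group_hom G B \<alpha>
    using coset_action_hom[OF H] group_BijGroup is_group
    by (simp add: group_hom_def group_hom_axioms_def \<alpha>_def B_def)
  have "group P"
    unfolding P_def using \<alpha>.img_is_subgroup by (rule \<alpha>.H.subgroup_imp_group)
  have "Bij (rcosets H) \<subseteq> (rcosets H) \<rightarrow>\<^sub>E (rcosets H)"
    by (auto simp: Bij_def PiE_def dest: bij_betwE)
  then have "finite (carrier B)"
    unfolding B_def BijGroup_def using finite_PiE[OF fin fin] finite_subset by auto
  then have "finite (carrier P)"
    unfolding P_def using \<alpha>.hom_closed by (auto intro: finite_subset[of _ "carrier B"])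
  have "p_group p P"
  proof (rule p_group_if_exponent_prime_power[OF p \<open>group P\<close> \<open>finite (carrier P)\<close>])
    fix y assume "y \<in> carrier P"
    then obtain x where x: "x \<in> carrier G" "y = \<alpha> x"
      unfolding P_def by auto
    have conj_pow: "(z \<otimes> x \<otimes> inv z) [^] k = z \<otimes> x [^] k \<otimes> inv z"
      if "z \<in> carrier G" for z and k :: nat
    proof (induction k)
      case (Suc k)
      have "inv z \<otimes> (z \<otimes> (x \<otimes> inv z)) = x \<otimes> inv z"
        using that x(1) by (simp flip: m_assoc)
      then show ?case
        using Suc that x(1) by (simp add: m_assoc)
    qed (use that in simp)
    have "z \<otimes> x [^] (p ^ n) \<otimes> inv z \<in> H" if "z \<in> carrier G" for z
      using powers[of "z \<otimes> x \<otimes> inv z"] conj_pow that x(1) by simp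
    then have "\<alpha> (x [^] (p ^ n)) = \<one>\<^bsub>B\<^esub>"
      unfolding \<alpha>_def B_def using coset_action_eq_one_iff[OF H] x(1) by simp
    then show "y [^]\<^bsub>P\<^esub> (p ^ n) = \<one>\<^bsub>P\<^esub>"
      unfolding P_def using x by (simp add: \<alpha>.hom_nat_pow flip: \<alpha>.H.nat_pow_consistent)
  qed
  moreover have "\<alpha> \<in> hom G P"
    unfolding P_def using \<alpha>.homh by (auto simp: hom_def)
  moreover have "\<alpha> g \<noteq> \<one>\<^bsub>P\<^esub>"
    using coset_action_eq_one_iff[OF H g(1)] g
    by (auto simp: P_def \<alpha>_def B_def dest!: bspec[of _ _ \<one>])
  ultimately show ?thesis
    using that by blast
qed

section \<open>Subnormal chains with factors of order p\<close>

lemma pow_mem_if_quotient_order: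
  assumes K: "subgroup K G" and N: "N \<lhd> G\<lparr>carrier := K\<rparr>"
    and ord: "order (G\<lparr>carrier := K\<rparr> Mod N) = p" and x: "x \<in> K"
  shows "x [^] p \<in> N"
proof -
  interpret N: normal N "G\<lparr>carrier := K\<rparr>" by fact
  interpret Q: group "G\<lparr>carrier := K\<rparr> Mod N"
    by (rule N.factorgroup_is_group)
  have "N #> x \<in> carrier (G\<lparr>carrier := K\<rparr> Mod N)"
    using x by (auto simp: carrier_FactGroup)
  then have "N #> x [^] p = N"
    using Q.pow_order_eq_1[of "N #> x"] N.FactGroup_pow[of x p] x ord
    by (simp flip: nat_pow_consistent)
  moreover have "x [^] p \<in> carrier G" "subgroup N G"
    using x K N incl_subgroup normal_imp_subgroup by (auto simp: subgroup.mem_carrier)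
  ultimately show ?thesis
    using coset_join1 subgroup.subset by blast
qed

lemma finite_transversal_if_finite_quotient:
  assumes K: "subgroup K G" and N: "N \<lhd> G\<lparr>carrier := K\<rparr>"
    and fin: "finite (carrier (G\<lparr>carrier := K\<rparr> Mod N))"
  obtains T where "finite T" "T \<subseteq> K" "K = N <#> T"
proof -
  interpret N: normal N "G\<lparr>carrier := K\<rparr>" by fact
  have cosets: "carrier (G\<lparr>carrier := K\<rparr> Mod N) = (\<lambda>x. N #> x) ` K"
    by (simp add: carrier_FactGroup)
  then obtain T where T: "T \<subseteq> K" "finite T" "(\<lambda>x. N #> x) ` K = (\<lambda>x. N #> x) ` T"
    using finite_subset_image[of "carrier (G\<lparr>carrier := K\<rparr> Mod N)" "\<lambda>x. N #> x" K] fin by auto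
  have "x \<in> N <#> T" if x: "x \<in> K" for x
  proof -
    have "subgroup N G"
      using K N incl_subgroup normal_imp_subgroup by blast
    then have "x \<in> N #> x"
      using x K rcos_self subgroup.mem_carrier by metis
    moreover obtain t where "t \<in> T" "N #> x = N #> t"
      using T(3) x by blast
    ultimately show ?thesis
      unfolding set_mult_def r_coset_def by auto
  qed
  then have "K \<subseteq> N <#> T"
    by (rule subsetI)
  moreover have "N <#> T \<subseteq> K"
    using T(1) N.subset K by (auto simp: set_mult_def intro: subgroup.m_closed)
  ultimately have "K = N <#> T"
    by (rule subset_antisym)
  with T(2,1) show ?thesis
    by (rule that)
qed

text \<open>
  Each \<open>p\<close>-th power pushes an element one step down the chain, and coset representatives for the
  factors multiply up to coset representatives for \<open>H 0\<close>. Both parts climb the same chain, so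
  they share an induction.
\<close>
lemma subnormal_chain_powers_and_index:
  fixes p :: nat and H :: "nat \<Rightarrow> 'a set"
  assumes p: "p > 0" and sub: "\<And>i. i \<le> n \<Longrightarrow> subgroup (H i) G"
    and normal: "\<And>i. i < n \<Longrightarrow> H i \<lhd> G\<lparr>carrier := H (Suc i)\<rparr>"
    and quotient: "\<And>i. i < n \<Longrightarrow> order (G\<lparr>carrier := H (Suc i)\<rparr> Mod H i) = p"
  shows "i \<le> n \<Longrightarrow> (\<forall>x \<in> H i. x [^] (p ^ i) \<in> H 0) \<and>
    (\<exists>S. finite S \<and> S \<subseteq> carrier G \<and> H i = H 0 <#> S)"
proof (induction i)
  case 0
  have H0: "H 0 \<subseteq> carrier G"
    using sub[of 0] by (simp add: subgroup.subset)
  then have "H 0 = H 0 <#> {\<one>}"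
    using r_coset_eq_set_mult coset_mult_one by metis
  then have "\<exists>S. finite S \<and> S \<subseteq> carrier G \<and> H 0 = H 0 <#> S"
    by (intro exI[of _ "{\<one>}"]) simp
  then show ?case
    using H0 by auto
next
  case (Suc i)
  then have i: "i < n" "i \<le> n" "Suc i \<le> n"
    by auto
  have powers: "x [^] (p ^ Suc i) \<in> H 0" if x: "x \<in> H (Suc i)" for x
  proof -
    have "x \<in> carrier G"
      using x sub[OF i(3)] subgroup.mem_carrier by metis
    moreover have "(x [^] p) [^] (p ^ i) \<in> H 0"
      using pow_mem_if_quotient_order[OF sub[OF i(3)] normal[OF i(1)] quotient[OF i(1)] x] Suc.IH i
      by blast
    ultimately show ?thesis
      by (simp add: nat_pow_pow)
  qed
  obtain S where S: "finite S" "S \<subseteq> carrier G" "H i = H 0 <#> S"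
    using Suc.IH i by blast
  have "finite (carrier (G\<lparr>carrier := H (Suc i)\<rparr> Mod H i))"
    using quotient[OF i(1)] p by (simp add: order_def card_ge_0_finite)
  then obtain T where T: "finite T" "T \<subseteq> H (Suc i)" "H (Suc i) = H i <#> T"
    using finite_transversal_if_finite_quotient[OF sub[OF i(3)] normal[OF i(1)]] by blast
  have "T \<subseteq> carrier G"
    using T(2) sub[OF i(3)] subgroup.subset by blast
  then have "H (Suc i) = H 0 <#> (S <#> T)" "S <#> T \<subseteq> carrier G"
    using S T(3) sub[of 0] by (simp_all add: set_mult_assoc subgroup.subset setmult_subset_G)
  moreover have "finite (S <#> T)"
    using S(1) T(1) by (simp add: set_mult_def)
  ultimately show ?case
    using powers by blast
qed

lemma finite_rcosets_if_finite_transversal: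
  assumes sub: "subgroup H G" and S: "finite S" "S \<subseteq> carrier G" "carrier G = H <#> S"
  shows "finite (rcosets H)"
proof -
  have "H #> x \<in> (\<lambda>s. H #> s) ` S" if x: "x \<in> carrier G" for x
  proof -
    obtain h s where "h \<in> H" "s \<in> S" "x = h \<otimes> s"
      using x S(3) unfolding set_mult_def by blast
    moreover have "H \<subseteq> carrier G"
      using sub by (rule subgroup.subset)
    ultimately have "H #> x = H #> s"
      using sub S(2) by (metis coset_join2 coset_mult_assoc subsetD)
    then show ?thesis
      using \<open>s \<in> S\<close> by blast
  qed
  then have "rcosets H \<subseteq> (\<lambda>s. H #> s) ` S"
    unfolding RCOSETS_def by blast
  then show ?thesis
    using S(1) finite_surj by blast
qed

end

theorem proposition3p2:
  fixes p :: nat and G :: "('a, 'b) monoid_scheme"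
  assumes "Factorial_Ring.prime p"
    and "group G"
    and "weakly_residually_p_nilpotent p G"
  shows "residually_p p G"
  unfolding residually_p_def
proof (intro ballI impI)
  interpret group G by fact
  fix g assume g: "g \<in> carrier G" "g \<noteq> \<one>\<^bsub>G\<^esub>"
  then have "\<exists>n H. H n = carrier G \<and> (\<forall>i \<le> n. subgroup (H i) G) \<and>
      (\<forall>i < n. H i \<lhd> G\<lparr>carrier := H (Suc i)\<rparr> \<and>
        G\<lparr>carrier := H (Suc i)\<rparr> Mod H i \<cong> integer_mod_group p) \<and> g \<notin> H 0"
    using assms(3) unfolding weakly_residually_p_nilpotent_def by simp
  then obtain n H where top: "H n = carrier G"
    and sub: "\<And>i. i \<le> n \<Longrightarrow> subgroup (H i) G"
    and normal: "\<And>i. i < n \<Longrightarrow> H i \<lhd> G\<lparr>carrier := H (Suc i)\<rparr>"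
    and iso: "\<And>i. i < n \<Longrightarrow> G\<lparr>carrier := H (Suc i)\<rparr> Mod H i \<cong> integer_mod_group p"
    and notin: "g \<notin> H 0"
    by (elim exE conjE) simp
  have "p > 0"
    using assms(1) by (rule prime_gt_0_nat)
  have "order (G\<lparr>carrier := H (Suc i)\<rparr> Mod H i) = p" if "i < n" for i
    using iso[OF that] iso_same_order \<open>p > 0\<close>
    by (fastforce simp: is_iso_def order_def carrier_integer_mod_group)
  then have powers: "\<And>x. x \<in> carrier G \<Longrightarrow> x [^]\<^bsub>G\<^esub> (p ^ n) \<in> H 0"
    and "\<exists>S. finite S \<and> S \<subseteq> carrier G \<and> carrier G = H 0 <#>\<^bsub>G\<^esub> S"
    using subnormal_chain_powers_and_index[of p n H n, OF \<open>p > 0\<close> sub normal] top by auto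
  then have "finite (rcosets\<^bsub>G\<^esub> (H 0))"
    using finite_rcosets_if_finite_transversal sub[of 0] by blast
  then obtain P :: "('a set \<Rightarrow> 'a set) monoid" and \<alpha>
    where "p_group p P" "\<alpha> \<in> hom G P" "\<alpha> g \<noteq> \<one>\<^bsub>P\<^esub>"
    using p_group_quotient_if_powers_in_subgroup[OF assms(1) sub[of 0] _ powers g(1) notin] by blast
  then show "\<exists>(Q :: nat monoid) \<beta>. p_group p Q \<and> \<beta> \<in> hom G Q \<and> \<beta> g \<noteq> \<one>\<^bsub>Q\<^esub>"
    using g(1) by (intro residually_p_witness)
qed

end
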